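(* For $R=\mathbb{Z}_{25}$ and for $R=\mathbb{S}_5=\mathbb{F}_5[X]/(X^2)$ there exist projective arcs with parameters $(355,15)$, $(375,16)$ and $(395,17)$ in $\mathrm{PHG}(2,R)$.
   Context: For a finite chain ring $R$ of length $2$ with residue field $\mathbb{F}_q$, the projective Hjelmslev plane $\mathrm{PHG}(2,R)$ is the incidence structure whose points are the free rank-$1$ submodules of the right module $R_R^3$, whose lines are the free rank-$2$ submodules of $R_R^3$, with incidence given by inclusion. A projective $(k,n)$-arc is a set of $k$ points meeting every line in at most $n$ points. *)

theory Defs
  imports Main "HOL-Library.Numeral_Type"
begin

section \<open>The ring S_q = F_q[X]/(X^2) as dual numbers a + bX over a base ring\<close>

datatype 'a dual = Dual 'a 'a

fun dfst :: "'a dual \<Rightarrow> 'a" where "dfst (Dual a b) = a"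
fun dsnd :: "'a dual \<Rightarrow> 'a" where "dsnd (Dual a b) = b"

lemma dual_eq_iff: "x = y \<longleftrightarrow> dfst x = dfst y \<and> dsnd x = dsnd y"
  by (cases x; cases y) auto

instantiation dual :: (comm_ring_1) comm_ring_1
begin
definition "0 = Dual 0 0"
definition "1 = Dual 1 0"
definition "x + y = Dual (dfst x + dfst y) (dsnd x + dsnd y)"
definition "x - y = Dual (dfst x - dfst y) (dsnd x - dsnd y)"
definition "- x = Dual (- dfst x) (- dsnd x)"
definition "x * y = Dual (dfst x * dfst y) (dfst x * dsnd y + dsnd x * dfst y)"
instance
  by standard (auto simp: dual_eq_iff zero_dual_def one_dual_def plus_dual_def
      minus_dual_def uminus_dual_def times_dual_def algebra_simps)
end

text \<open>S_5 = F_5[X]/(X^2); the element Dual a b stands for a + b X.\<close>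
type_synonym S5 = "5 dual"

type_synonym 'a vec3 = "'a \<times> 'a \<times> 'a"

definition vadd :: "'a::comm_ring_1 vec3 \<Rightarrow> 'a vec3 \<Rightarrow> 'a vec3" where
  "vadd x y = (fst x + fst y, fst (snd x) + fst (snd y), snd (snd x) + snd (snd y))"

definition vsmul :: "'a::comm_ring_1 vec3 \<Rightarrow> 'a \<Rightarrow> 'a vec3" where
  "vsmul x r = (fst x * r, fst (snd x) * r, snd (snd x) * r)"

text \<open>Free rank-1 submodules: xR with r \<mapsto> xr injective (x is a basis).\<close>
definition hpoints :: "('a::comm_ring_1 vec3) set set" where
  "hpoints = {range (\<lambda>r. vsmul x r) | x. inj (\<lambda>r. vsmul x r)}"

text \<open>Free rank-2 submodules: xR + yR with (r,s) \<mapsto> xr + ys injective.\<close>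
definition hlines :: "('a::comm_ring_1 vec3) set set" where
  "hlines = {range (\<lambda>(r, s). vadd (vsmul x r) (vsmul y s)) | x y.
              inj (\<lambda>(r, s). vadd (vsmul x r) (vsmul y s))}"

definition proj_arc :: "('a::comm_ring_1 vec3) set set \<Rightarrow> nat \<Rightarrow> nat \<Rightarrow> bool" where
  "proj_arc K k n \<longleftrightarrow> K \<subseteq> hpoints \<and> card K = k \<and>
     (\<forall>L \<in> hlines. card {P \<in> K. P \<subseteq> L} \<le> n)"

end

theory Submission
  imports Defs "HOL-Computational_Algebra.Primes"
begin

text \<open>
  Let \<open>\<pi>\<close> generate the maximal ideal of \<open>R\<close>.  Reduction modulo \<open>\<pi>\<close> maps the Hjelmslev plane onto
  \<open>PG(2,5)\<close>; the fibre over a point \<open>x\<close> is an affine plane of order 5 whose six parallel classes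
  correspond to the lines through \<open>x\<close>.  Choose for every \<open>x\<close> one line \<open>d\<^sub>x\<close> through \<open>x\<close> and take in the
  fibre \<open>|T\<^sub>x|\<close> of the five segments of direction \<open>d\<^sub>x\<close>.  A line over \<open>l\<close> meets the fibre over a point
  \<open>x\<close> of \<open>l\<close> in exactly \<open>|T\<^sub>x|\<close> chosen points if \<open>l \<noteq> d\<^sub>x\<close>, and in 5 or 0 chosen points if
  \<open>l = d\<^sub>x\<close>.  Which of the two occurs depends only on the reduced data, because each fibre is special
  for a single line only and its segments can be numbered compatibly with that line.  So the problem becomes
  a finite one over \<open>F\<^sub>5\<close>, the same for both rings, and it has solutions with
  \<open>\<Sum>|T\<^sub>x| = 71, 75, 79\<close> for \<open>n = 15, 16, 17\<close>; these were found by a computer search.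
\<close>

section \<open>Covectors and cross products\<close>

fun dot :: "'a::comm_ring_1 vec3 \<Rightarrow> 'a vec3 \<Rightarrow> 'a" where
  "dot (a, b, c) (a', b', c') = a * a' + b * b' + c * c'"

fun cross :: "'a::comm_ring_1 vec3 \<Rightarrow> 'a vec3 \<Rightarrow> 'a vec3" where
  "cross (a, b, c) (a', b', c') = (b * c' - c * b', c * a' - a * c', a * b' - b * a')"

fun emb :: "int vec3 \<Rightarrow> 'a::comm_ring_1 vec3" where
  "emb (a, b, c) = (of_int a, of_int b, of_int c)"

lemma dot_vadd_right: "dot l (vadd x y) = dot l x + dot l y"
  by (cases l; cases x; cases y) (simp add: vadd_def algebra_simps)

lemma dot_vadd_left: "dot (vadd x y) l = dot x l + dot y l"
  by (cases l; cases x; cases y) (simp add: vadd_def algebra_simps)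

lemma dot_vsmul_right: "dot l (vsmul x r) = dot l x * r"
  by (cases l; cases x) (simp add: vsmul_def algebra_simps)

lemma dot_vsmul_left: "dot (vsmul x r) l = dot x l * r"
  by (cases l; cases x) (simp add: vsmul_def algebra_simps)

lemmas dot_simps = dot_vadd_right dot_vadd_left dot_vsmul_right dot_vsmul_left

lemma dot_zero_left: "dot (0, 0, 0) x = 0"
  by (cases x) simp

lemma dot_emb: "dot (emb l) (emb x) = of_int (dot l x)"
  by (cases l; cases x) simp

lemma dot_cross_left: "dot (cross x y) x = 0"
  by (cases x; cases y) (simp add: algebra_simps)

lemma dot_cross_right: "dot (cross x y) y = 0"
  by (cases x; cases y) (simp add: algebra_simps)

lemma vsmul_1: "vsmul x 1 = x"
  by (simp add: vsmul_def)

section \<open>The finite problem over the field with five elements\<close>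

text \<open>One vector for each of the 31 points, equally of the 31 lines, of the reduced plane: the
  first nonzero coordinate is 1.\<close>

definition residue_vecs :: "int vec3 list" where
  "residue_vecs = [(1, b, c). b \<leftarrow> [0..4], c \<leftarrow> [0..4]] @ [(0, 1, c). c \<leftarrow> [0..4]] @ [(0, 0, 1)]"

definition small_vecs :: "int vec3 list" where
  "small_vecs = [(a, b, c). a \<leftarrow> [0..4], b \<leftarrow> [0..4], c \<leftarrow> [0..4]]"

lemma set_small_vecs: "set small_vecs = {0..4} \<times> {0..4} \<times> {0..4}"
  unfolding small_vecs_def by auto

text \<open>The unit vector at the leading coordinate of a normalised \<open>d\<close>. Adding
  \<open>j\<close> times it to the \<pi>-part of a point shifts the value of \<open>d\<close> there
  by \<pi> times \<open>j\<close>, so \<open>j\<close> can number the segments of direction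
  \<open>d\<close>.\<close>

fun pivot :: "int vec3 \<Rightarrow> int vec3" where
  "pivot (a, b, c) = (if a = 1 then (1, 0, 0) else if b = 1 then (0, 1, 0) else (0, 0, 1))"

lemma dot_pivot: "d \<in> set residue_vecs \<Longrightarrow> dot d (pivot d) = 1"
  unfolding residue_vecs_def by auto

text \<open>A row \<open>(x, d, e, T)\<close> describes a union of parallel line segments inside the neighbour class
  of the point \<open>x\<close> of the projective plane over \<open>F\<^sub>5\<close>: the segments have the direction of the
  line \<open>d\<close> through \<open>x\<close>, on which \<open>e\<close> is a second point, and \<open>T\<close> lists which of the five
  segments are taken.  The lift of \<open>x\<close> is chosen with \<open>dot d x = 0\<close> over the integers, so that
  the numbering of the segments is the same over all rings considered.\<close>
type_synonym row = "int vec3 \<times> int vec3 \<times> int vec3 \<times> int list"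

text \<open>The last two conditions make \<open>x\<close> and \<open>e\<close> reduce to distinct
  points: \<open>d\<close> is the only line through both, and some line passes through
  \<open>x\<close> but not \<open>e\<close>.\<close>

fun good_row :: "row \<Rightarrow> bool" where
  "good_row (x, d, e, T) \<longleftrightarrow>
     d \<in> set residue_vecs \<and> dot d x = 0 \<and> 5 dvd dot d e \<and> distinct T \<and> list_all (\<lambda>j. 0 \<le> j \<and> j \<le> 4) T \<and>
     list_all (\<lambda>l. 5 dvd dot l x \<longrightarrow> 5 dvd dot l e \<longrightarrow> l = d) residue_vecs \<and>
     list_ex (\<lambda>l. 5 dvd dot l x \<and> \<not> 5 dvd dot l e) residue_vecs"

fun cong_smul :: "int vec3 \<Rightarrow> int vec3 \<Rightarrow> int \<Rightarrow> bool" where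
  "cong_smul (a, b, c) (a', b', c') k \<longleftrightarrow> 5 dvd a - a' * k \<and> 5 dvd b - b' * k \<and> 5 dvd c - c' * k"

text \<open>Starting \<open>k\<close> at 0 serves two purposes: distinct rows lie over distinct
  points of the reduced plane, and comparing a row with itself at \<open>k = 0\<close> shows that
  \<open>x\<close> does not vanish modulo 5.\<close>

definition good_rows :: "row list \<Rightarrow> bool" where
  "good_rows R \<longleftrightarrow> distinct R \<and> list_all good_row R \<and>
     list_all (\<lambda>r. list_all (\<lambda>r'. list_all (\<lambda>k. cong_smul (fst r) (fst r') k \<longrightarrow> r = r' \<and> k = 1) [0..4]) R) R"

text \<open>Here \<open>l\<close> plus \<pi> times \<open>m\<close> is the covector of a line over
  \<open>l\<close>. Fibres of direction other than \<open>l\<close> contribute \<open>A\<close>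
  whatever \<open>m\<close> is, so \<open>A\<close> stays outside the loop over the 125 values of
  \<open>m\<close>; a fibre of direction \<open>l\<close> contributes 5 if the one segment that is
  hit has been taken.\<close>

definition load_bound :: "nat \<Rightarrow> row list \<Rightarrow> bool" where
  "load_bound n R \<longleftrightarrow> list_all (\<lambda>l.
     let A = (\<Sum>(x, d, e, T) \<leftarrow> R. if d \<noteq> l \<and> 5 dvd dot l x then length T else 0);
         S = filter (\<lambda>(x, d, e, T). d = l) R
     in list_all (\<lambda>m. A + (\<Sum>(x, d, e, T) \<leftarrow> S. if (- dot m x) mod 5 \<in> set T then 5 else 0) \<le> n) small_vecs)
     residue_vecs"

lemma small_vec_normalise:
  assumes "x \<in> set small_vecs" "x \<noteq> (0, 0, 0)"
  shows "\<exists>k. \<exists>l\<in>set residue_vecs. cong_smul l x k"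
proof -
  have "list_all (\<lambda>x. x = (0, 0, 0) \<or>
      list_ex (\<lambda>k. list_ex (\<lambda>l. cong_smul l x k) residue_vecs) [1..4]) small_vecs"
    by code_simp
  then show ?thesis using assms unfolding list_all_iff list_ex_iff by blast
qed

lemma eq_if_5_dvd_diff: "i = j" if "5 dvd i - j" "i \<in> {0..4}" "j \<in> {0..4}" for i j :: int
  using that unfolding atLeastAtMost_iff by presburger

section \<open>Arithmetic of the chain ring\<close>

text \<open>What the integers modulo 25 (with \<pi> = 5) and \<open>S5\<close> (with \<pi> = X)
  share: \<pi> squares to zero, it kills exactly the integers divisible by 5, and every element has
  a two-digit \<pi>-adic expansion with integer digits.\<close>

locale chain_ring5 =
  fixes \<pi> :: "'a::comm_ring_1"
  assumes pi_pi: "\<pi> * \<pi> = 0"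
    and pi_of_int_eq_0_iff: "\<pi> * of_int k = 0 \<longleftrightarrow> 5 dvd k"
    and pi_dvd_5: "\<pi> dvd 5"
    and decomp: "\<exists>a b. r = of_int a + \<pi> * of_int b"
begin

lemma pi_dvd_of_int_iff: "\<pi> dvd of_int k \<longleftrightarrow> 5 dvd k"
proof
  assume "\<pi> dvd of_int k"
  then obtain s where "of_int k = \<pi> * s" by (elim dvdE)
  then have "\<pi> * of_int k = \<pi> * \<pi> * s" by (simp add: mult.assoc)
  then show "5 dvd k" by (simp add: pi_pi pi_of_int_eq_0_iff)
next
  assume "5 dvd k"
  then obtain c where "k = 5 * c" by (elim dvdE)
  then show "\<pi> dvd of_int k" using pi_dvd_5 by simp
qed

text \<open>Both sides depend only on the leading digit \<open>a\<close>, and there both mean that 5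
  divides it.\<close>

lemma pi_mult_eq_0_iff: "\<pi> * r = 0 \<longleftrightarrow> \<pi> dvd r"
proof -
  obtain a b where r: "r = of_int a + \<pi> * of_int b" using decomp by blast
  have "\<pi> * r = \<pi> * of_int a + \<pi> * \<pi> * of_int b"
    by (simp add: r algebra_simps)
  then have "\<pi> * r = 0 \<longleftrightarrow> \<pi> dvd of_int a"
    by (simp add: pi_pi pi_of_int_eq_0_iff pi_dvd_of_int_iff)
  then show ?thesis by (simp add: r dvd_add_left_iff)
qed

text \<open>Multiplying by an inverse of the leading digit modulo 5 gives
  \<open>1 + \<pi> * t\<close>, and \<open>1 - \<pi> * t\<close> inverts this since \<pi> squares to
  zero.\<close>

lemma unit_if_not_pi_dvd:
  assumes "\<not> \<pi> dvd r"
  shows "\<exists>s. r * s = 1"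
proof -
  obtain a b where r: "r = of_int a + \<pi> * of_int b" using decomp by blast
  have "\<not> 5 dvd a"
    using assms by (simp add: r dvd_add_left_iff pi_dvd_of_int_iff)
  then have "5 dvd a * 1 - 1 \<or> 5 dvd a * 2 - 1 \<or> 5 dvd a * 3 - 1 \<or> 5 dvd a * 4 - 1"
    by presburger
  then obtain a' where "5 dvd a * a' - 1" by blast
  then have "\<pi> dvd of_int (a * a' - 1)" by (simp only: pi_dvd_of_int_iff)
  then obtain c where "of_int (a * a' - 1) = \<pi> * c" by (elim dvdE)
  moreover define t where "t = c + of_int b * of_int a'"
  ultimately have t: "r * of_int a' = 1 + \<pi> * t"
    by (simp add: r algebra_simps)
  have "r * (of_int a' * (1 - \<pi> * t)) = (r * of_int a') * (1 - \<pi> * t)"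
    by (simp add: mult.assoc)
  also have "\<dots> = 1 - (\<pi> * \<pi>) * (t * t)"
    by (simp add: t algebra_simps)
  finally show ?thesis by (auto simp: pi_pi)
qed

section \<open>Unimodular vectors and the covectors of lines\<close>

definition unimodular :: "'a vec3 \<Rightarrow> bool" where
  "unimodular x \<longleftrightarrow> \<not> (\<pi> dvd fst x \<and> \<pi> dvd fst (snd x) \<and> \<pi> dvd snd (snd x))"

lemma inj_vsmul_if_unimodular:
  assumes "unimodular x"
  shows "inj (\<lambda>r. vsmul x r)"
proof
  fix r s assume eq: "vsmul x r = vsmul x s"
  obtain c where c: "\<not> \<pi> dvd c" and crs: "c * r = c * s"
    using assms eq by (auto simp: unimodular_def vsmul_def)
  obtain u where "c * u = 1" using unit_if_not_pi_dvd [OF c] by blast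
  then have "r = u * (c * r)" "s = u * (c * s)"
    by (simp_all add: mult.assoc [symmetric] mult.commute)
  then show "r = s" using crs by simp
qed

text \<open>The cross product of a basis annihilates the line, and freeness of the basis makes it
  unimodular. Inclusion of \<open>L\<close> in the kernel suffices for upper bounds on
  incidences.\<close>

lemma hline_annihilator:
  assumes "L \<in> hlines"
  obtains l where "unimodular l" "\<And>p. p \<in> L \<Longrightarrow> dot l p = 0"
proof -
  obtain x y where L: "L = range (\<lambda>(r, s). vadd (vsmul x r) (vsmul y s))"
    and inj: "inj (\<lambda>(r, s). vadd (vsmul x r) (vsmul y s))"
    using assms by (auto simp: hlines_def)
  obtain x1 x2 x3 y1 y2 y3 where xy: "x = (x1, x2, x3)" "y = (y1, y2, y3)"
    by (metis prod_cases3)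
  have ker: "r = 0 \<and> s = 0" if "vadd (vsmul x r) (vsmul y s) = (0, 0, 0)" for r s
    using injD [OF inj, of "(r, s)" "(0, 0)"] that by (simp add: vadd_def vsmul_def)
  have "\<pi> \<noteq> 0" using pi_of_int_eq_0_iff [of 1] by auto
  have "unimodular x"
  proof (rule ccontr)
    assume "\<not> unimodular x"
    then have "vadd (vsmul x \<pi>) (vsmul y 0) = (0, 0, 0)"
      by (auto simp: unimodular_def xy vadd_def vsmul_def pi_mult_eq_0_iff [symmetric] mult.commute)
    then show False using ker \<open>\<pi> \<noteq> 0\<close> by blast
  qed
  have "unimodular (cross x y)"
  proof (rule ccontr)
    assume "\<not> unimodular (cross x y)"
    then have 0: "\<pi> * (x2 * y3 - x3 * y2) = 0" "\<pi> * (x3 * y1 - x1 * y3) = 0" "\<pi> * (x1 * y2 - x2 * y1) = 0"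
      by (auto simp: unimodular_def xy pi_mult_eq_0_iff)
    have "\<pi> dvd xi" if "(xi, yi) \<in> {(x1, y1), (x2, y2), (x3, y3)}" for xi yi
    proof -
      \<comment> \<open>The coordinates of \<open>yi * x - xi * y\<close> are zero or, up to sign,
        entries of the cross product, and \<pi> kills those.\<close>
      have "vadd (vsmul x (\<pi> * yi)) (vsmul y (- \<pi> * xi)) = (0, 0, 0)"
        using that 0 by (auto simp: xy vadd_def vsmul_def algebra_simps)
      then have "\<pi> * xi = 0" using ker by fastforce
      then show ?thesis by (simp add: pi_mult_eq_0_iff)
    qed
    then have "\<pi> dvd x1" "\<pi> dvd x2" "\<pi> dvd x3" by blast+
    then show False using \<open>unimodular x\<close> by (simp add: unimodular_def xy)
  qed
  moreover have "dot (cross x y) p = 0" if "p \<in> L" for p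
    using that by (auto simp: L dot_simps dot_cross_left dot_cross_right)
  ultimately show thesis using that by blast
qed

section \<open>Lifts of reduced vectors\<close>

definition lift :: "int vec3 \<Rightarrow> int vec3 \<Rightarrow> 'a vec3" where
  "lift x v = vadd (emb x) (vsmul (emb v) \<pi>)"

lemma dot_lift: "dot (lift l m) (lift x v) = of_int (dot l x) + \<pi> * of_int (dot l v + dot m x)"
proof -
  have "dot (lift l m) (lift x v) =
      of_int (dot l x) + \<pi> * of_int (dot l v + dot m x) + of_int (dot m v) * (\<pi> * \<pi>)"
    by (simp add: lift_def dot_simps dot_emb algebra_simps)
  then show ?thesis by (simp add: pi_pi)
qed

text \<open>\<open>cong_smul x x 0\<close> serves to say that 5 divides every coordinate of
  \<open>x\<close>.\<close>

lemma unimodular_lift_iff: "unimodular (lift x v) \<longleftrightarrow> \<not> cong_smul x x 0"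
  by (cases x; cases v)
    (simp add: unimodular_def lift_def vadd_def vsmul_def dvd_add_left_iff pi_dvd_of_int_iff)

text \<open>Reduction with a carry: the multiple of 5 split off from the leading digit is a multiple
  of \<pi> and moves into the second digit, where multiples of 5 are killed by \<pi>.\<close>

lemma decomp_small: "\<exists>a\<in>{0..4}. \<exists>b\<in>{0..4}. r = of_int a + \<pi> * of_int b"
proof -
  have red: "\<exists>a'\<in>{0..4}. \<exists>c. a = a' + 5 * c" for a :: int
    by (intro bexI [of _ "a mod 5"] exI [of _ "a div 5"]) auto
  obtain a b where r: "r = of_int a + \<pi> * of_int b" using decomp by blast
  obtain a' c where a': "a' \<in> {0..4}" "a = a' + 5 * c" using red by blast
  have "\<pi> dvd of_int (5 * c)" by (simp only: pi_dvd_of_int_iff dvd_triv_left)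
  then obtain t where t: "of_int (5 * c) = \<pi> * t" by (elim dvdE)
  obtain p q where pq: "t = of_int p + \<pi> * of_int q" using decomp by blast
  obtain b' k where b': "b' \<in> {0..4}" "b + p = b' + 5 * k" using red by blast
  have "r = of_int a' + of_int (5 * c) + \<pi> * of_int b" by (simp add: r a')
  also have "\<dots> = of_int a' + \<pi> * of_int (b + p) + (\<pi> * \<pi>) * of_int q"
    unfolding t pq by (simp add: algebra_simps)
  also have "\<dots> = of_int a' + \<pi> * of_int b' + \<pi> * of_int (5 * k)"
    unfolding b' by (simp add: pi_pi algebra_simps)
  also have "\<pi> * of_int (5 * k) = 0" by (simp only: pi_of_int_eq_0_iff dvd_triv_left)
  finally have "r = of_int a' + \<pi> * of_int b'" by simp
  then show ?thesis using a'(1) b'(1) by blast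
qed

lemma lift_cases:
  obtains x v where "x \<in> set small_vecs" "v \<in> set small_vecs" "l = lift x v"
proof -
  obtain l1 l2 l3 where l: "l = (l1, l2, l3)" by (metis prod_cases3)
  obtain a1 b1 where 1: "a1 \<in> {0..4}" "b1 \<in> {0..4}" "l1 = of_int a1 + \<pi> * of_int b1"
    using decomp_small by blast
  obtain a2 b2 where 2: "a2 \<in> {0..4}" "b2 \<in> {0..4}" "l2 = of_int a2 + \<pi> * of_int b2"
    using decomp_small by blast
  obtain a3 b3 where 3: "a3 \<in> {0..4}" "b3 \<in> {0..4}" "l3 = of_int a3 + \<pi> * of_int b3"
    using decomp_small by blast
  show thesis
    by (rule that [of "(a1, a2, a3)" "(b1, b2, b3)"])
      (use 1 2 3 in \<open>auto simp: set_small_vecs l lift_def vadd_def vsmul_def mult.commute\<close>)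
qed

text \<open>A suitable integer factor makes the reduction one of the 31 normalised vectors; the
  remaining error is divisible by \<pi> and is absorbed in \<open>m\<close>.\<close>

lemma normalise_covector:
  assumes "unimodular l"
  obtains l' m k where "l' \<in> set residue_vecs" "m \<in> set small_vecs" "vsmul l k = lift l' m"
proof -
  obtain x v where x: "x \<in> set small_vecs" "l = lift x v" by (rule lift_cases)
  obtain a b c where abc: "x = (a, b, c)" by (metis prod_cases3)
  have "x \<noteq> (0, 0, 0)" using assms by (auto simp: x unimodular_lift_iff)
  obtain k l' where l': "l' \<in> set residue_vecs" "cong_smul l' x k"
    using small_vec_normalise [OF x(1) \<open>x \<noteq> (0, 0, 0)\<close>] by blast
  obtain a' b' c' where l'_eq: "l' = (a', b', c')" by (metis prod_cases3)
  have diff: "\<pi> dvd (of_int p + of_int q * \<pi>) * of_int k - of_int p'" if "5 dvd p' - p * k" for p q p'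
  proof -
    have "(of_int p + of_int q * \<pi>) * of_int k - of_int p' = \<pi> * (of_int q * of_int k) - of_int (p' - p * k)"
      by (simp add: algebra_simps)
    then show ?thesis using that by (simp only: pi_dvd_of_int_iff dvd_diff dvd_triv_left)
  qed
  have small: "\<exists>q\<in>{0..4}. r = \<pi> * of_int q" if "\<pi> dvd r" for r
  proof -
    obtain p q where pq: "p \<in> {0..4}" "q \<in> {0..4}" "r = of_int p + \<pi> * of_int q"
      using decomp_small by blast
    then have "5 dvd p" using that by (simp add: dvd_add_left_iff pi_dvd_of_int_iff)
    then have "p = 0" using pq(1) by (auto elim!: dvdE)
    then show ?thesis using pq by auto
  qed
  obtain v1 v2 v3 where v: "v = (v1, v2, v3)" by (metis prod_cases3)
  have "5 dvd a' - a * k" "5 dvd b' - b * k" "5 dvd c' - c * k"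
    using l'(2) by (simp_all add: l'_eq abc)
  then obtain m1 m2 m3 where m:
      "m1 \<in> {0..4}" "(of_int a + of_int v1 * \<pi>) * of_int k - of_int a' = \<pi> * of_int m1"
      "m2 \<in> {0..4}" "(of_int b + of_int v2 * \<pi>) * of_int k - of_int b' = \<pi> * of_int m2"
      "m3 \<in> {0..4}" "(of_int c + of_int v3 * \<pi>) * of_int k - of_int c' = \<pi> * of_int m3"
    using small [OF diff] by meson
  show thesis
  proof (rule that [OF l'(1)])
    show "(m1, m2, m3) \<in> set small_vecs" using m by (auto simp: set_small_vecs)
    show "vsmul l (of_int k) = lift l' (m1, m2, m3)"
      using m by (simp add: x abc v l'_eq lift_def vadd_def vsmul_def diff_eq_eq algebra_simps)
  qed
qed

section \<open>The points of the arc\<close>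

fun row_point :: "row \<times> int \<times> int \<Rightarrow> 'a vec3" where
  "row_point ((x, d, e, T), i, j) = lift x (vadd (vsmul e i) (vsmul (pivot d) j))"

declare row_point.simps [simp del]

definition row_indices :: "row list \<Rightarrow> (row \<times> int \<times> int) set" where
  "row_indices R = (SIGMA r : set R. {0..4} \<times> set (snd (snd (snd r))))"

definition row_arc :: "row list \<Rightarrow> 'a vec3 set set" where
  "row_arc R = (\<lambda>t. range (vsmul (row_point t))) ` row_indices R"

lemma card_row_indices:
  assumes "good_rows R"
  shows "card (row_indices R) = (\<Sum>(x, d, e, T) \<leftarrow> R. 5 * length T)"
proof -
  have "card (row_indices R) = (\<Sum>r\<in>set R. card ({0..4::int} \<times> set (snd (snd (snd r)))))"
    unfolding row_indices_def by (rule card_SigmaI) auto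
  also have "\<dots> = (\<Sum>r\<in>set R. case r of (x, d, e, T) \<Rightarrow> 5 * length T)"
    using assms
    by (intro sum.cong) (auto simp: good_rows_def list_all_iff card_cartesian_product distinct_card)
  finally show ?thesis
    using assms by (simp add: good_rows_def sum_list_distinct_conv_sum_set)
qed

text \<open>For a good row and \<open>l = d\<close>, the constant term vanishes,
  \<open>dot l e\<close> is 0 modulo 5 and \<open>dot l (pivot d)\<close> is 1. The value is then
  \<pi> times \<open>j + dot m x\<close>, so \<open>i\<close> runs along the segment numbered
  \<open>j\<close>.\<close>

lemma dot_row_point:
  "dot (lift l m) (row_point ((x, d, e, T), i, j)) =
     of_int (dot l x) + \<pi> * of_int (i * dot l e + j * dot l (pivot d) + dot m x)"
  by (simp add: row_point.simps dot_lift dot_simps mult.commute)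

lemma cong_smul_if_lift_eq:
  assumes "lift x v = vsmul (lift x' v') r" "r = of_int a + \<pi> * of_int b"
  shows "cong_smul x x' a"
proof -
  have *: "5 dvd p - p' * a"
    if "of_int p + of_int q * \<pi> = (of_int p' + of_int q' * \<pi>) * r" for p q p' q'
  proof -
    have "of_int (p - p' * a) = \<pi> * (of_int q' * r + of_int p' * of_int b - of_int q)"
      using that by (simp add: assms(2) algebra_simps)
    then have "\<pi> dvd of_int (p - p' * a)" by simp
    then show ?thesis by (simp only: pi_dvd_of_int_iff)
  qed
  show ?thesis
    using assms(1) * by (cases x; cases x'; cases v; cases v') (auto simp: lift_def vadd_def vsmul_def)
qed

text \<open>Reduction modulo \<pi> identifies the rows and forces \<open>r\<close> to be 1 modulo
  \<pi>. Covectors vanishing at \<open>x\<close> modulo 5 then recover the coordinates: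
  \<open>d\<close> gives \<open>j\<close>, and a line through \<open>x\<close> but not
  \<open>e\<close> gives \<open>i\<close>.\<close>

lemma row_point_inj:
  assumes R: "good_rows R" and t: "t \<in> row_indices R" and t': "t' \<in> row_indices R"
    and eq: "row_point t = vsmul (row_point t') r"
  shows "t = t'"
proof -
  obtain x d e T i j where t_eq: "t = ((x, d, e, T), i, j)" by (metis prod_cases3)
  obtain x' d' e' T' i' j' where t'_eq: "t' = ((x', d', e', T'), i', j')" by (metis prod_cases3)
  obtain a b where ab: "a \<in> {0..4}" "r = of_int a + \<pi> * of_int b" using decomp_small by blast
  have rows: "(x, d, e, T) \<in> set R" "(x', d', e', T') \<in> set R"
    using t t' by (auto simp: row_indices_def t_eq t'_eq)
  have "cong_smul x x' a"
    using cong_smul_if_lift_eq [OF _ ab(2)] eq by (simp add: t_eq t'_eq row_point.simps)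
  moreover have "\<And>r r' k. r \<in> set R \<Longrightarrow> r' \<in> set R \<Longrightarrow> k \<in> {0..4} \<Longrightarrow>
      cong_smul (fst r) (fst r') k \<Longrightarrow> r = r' \<and> k = 1"
    using R by (simp add: good_rows_def list_all_iff)
  ultimately have same: "(x, d, e, T) = (x', d', e', T')" and "a = 1"
    using rows ab(1) by (metis fst_conv)+
  then have r: "r = 1 + \<pi> * of_int b" by (simp add: ab)
  have good: "good_row (x, d, e, T)"
    using R rows by (simp add: good_rows_def list_all_iff del: good_row.simps)
  have ij: "i \<in> {0..4}" "i' \<in> {0..4}" "j \<in> {0..4}" "j' \<in> {0..4}"
    using t t' good same by (auto simp: row_indices_def t_eq t'_eq list_all_iff)
  \<comment> \<open>Since \<pi> kills \<open>dot l x\<close>, the second digit of \<open>r\<close>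
    has no effect and the \<pi>-parts can be compared.\<close>
  have key: "5 dvd (i - i') * dot l e + (j - j') * dot l (pivot d)" if "5 dvd dot l x" for l
  proof -
    have e0: "of_int (dot l x) * \<pi> = 0"
      using that pi_of_int_eq_0_iff by (simp add: mult.commute)
    have "dot (lift l (0, 0, 0)) (row_point t) = dot (lift l (0, 0, 0)) (row_point t') * r"
      by (simp add: eq dot_simps)
    then have "of_int (dot l x) + \<pi> * of_int (i * dot l e + j * dot l (pivot d)) =
        (of_int (dot l x) + \<pi> * of_int (i' * dot l e + j' * dot l (pivot d))) * (1 + \<pi> * of_int b)"
      using same by (simp add: dot_zero_left t_eq t'_eq dot_row_point r)
    also have "\<dots> = of_int (dot l x) + \<pi> * of_int (i' * dot l e + j' * dot l (pivot d))
        + of_int (dot l x) * \<pi> * of_int b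
        + (\<pi> * \<pi>) * (of_int (i' * dot l e + j' * dot l (pivot d)) * of_int b)"
      by (simp add: algebra_simps del: of_int_add of_int_mult)
    finally have "\<pi> * of_int (i * dot l e + j * dot l (pivot d)) =
        \<pi> * of_int (i' * dot l e + j' * dot l (pivot d))"
      by (simp add: e0 pi_pi)
    then have "\<pi> * of_int ((i - i') * dot l e + (j - j') * dot l (pivot d)) = 0"
      by (simp add: algebra_simps)
    then show ?thesis by (simp only: pi_of_int_eq_0_iff)
  qed
  have "5 dvd (i - i') * dot d e + (j - j')"
    using key [of d] good by (simp add: dot_pivot)
  moreover have "5 dvd (i - i') * dot d e" using good by simp
  ultimately have "5 dvd j - j'" by (simp add: dvd_add_right_iff)
  then have jj: "j = j'" using ij eq_if_5_dvd_diff by blast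
  obtain l where l: "5 dvd dot l x" "\<not> 5 dvd dot l e"
    using good by (auto simp: list_ex_iff)
  have "5 dvd (i - i') * dot l e" using key [OF l(1)] jj by simp
  moreover have "prime (5 :: int)" by simp
  ultimately have "5 dvd i - i'" using l(2) prime_dvd_mult_iff by blast
  then have "i = i'" using ij eq_if_5_dvd_diff by blast
  then show ?thesis using jj same by (simp add: t_eq t'_eq)
qed

lemma card_row_arc:
  assumes "good_rows R"
  shows "card (row_arc R) = (\<Sum>(x, d, e, T) \<leftarrow> R. 5 * length T)"
proof -
  have "inj_on (\<lambda>t. range (vsmul (row_point t))) (row_indices R)"
  proof
    fix t t' assume t: "t \<in> row_indices R" "t' \<in> row_indices R"
      and "range (vsmul (row_point t)) = range (vsmul (row_point t'))"
    then have "vsmul (row_point t) 1 \<in> range (vsmul (row_point t'))" by blast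
    then obtain r where "row_point t = vsmul (row_point t') r" by (auto simp: vsmul_1)
    then show "t = t'" using row_point_inj [OF assms t] by blast
  qed
  then show ?thesis
    unfolding row_arc_def by (simp add: card_image card_row_indices [OF assms])
qed

lemma row_arc_subset_hpoints:
  assumes R: "good_rows R"
  shows "row_arc R \<subseteq> hpoints"
proof
  fix P assume "P \<in> row_arc R"
  then obtain t where t: "t \<in> row_indices R" "P = range (vsmul (row_point t))"
    by (auto simp: row_arc_def)
  obtain x d e T i j where t_eq: "t = ((x, d, e, T), i, j)" by (metis prod_cases3)
  have row: "(x, d, e, T) \<in> set R" using t by (auto simp: row_indices_def t_eq)
  have "unimodular (row_point t)"
  proof (rule ccontr)
    assume "\<not> unimodular (row_point t)"
    then have "cong_smul x x 0" by (simp add: t_eq row_point.simps unimodular_lift_iff)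
    \<comment> \<open>Comparing the row with itself would force 0 = 1 for the factor
      \<open>k\<close>.\<close>
    then show False using R row by (force simp: good_rows_def list_all_iff)
  qed
  then show "P \<in> hpoints"
    using inj_vsmul_if_unimodular unfolding hpoints_def t(2) by blast
qed

section \<open>Counting the chosen points on a line\<close>

text \<open>If \<open>d = l\<close>, incidence fixes \<open>j\<close> and leaves \<open>i\<close>
  free. If \<open>d\<close> differs from \<open>l\<close> and \<open>l\<close> passes through
  \<open>x\<close>, then \<open>dot l e\<close> is invertible modulo 5, so each \<open>j\<close>
  allows at most one \<open>i\<close>. If \<open>l\<close> misses \<open>x\<close>, incidence would
  make a unit divisible by \<pi>.\<close>

lemma card_incident_row_points:
  assumes R: "good_rows R" and l: "l \<in> set residue_vecs" and r: "r = (x, d, e, T)" "r \<in> set R"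
  shows "card {(i, j) \<in> {0..4} \<times> set T. dot (lift l m) (row_point (r, i, j)) = 0} \<le>
    (if d \<noteq> l \<and> 5 dvd dot l x then length T else 0) +
    (if d = l \<and> (- dot m x) mod 5 \<in> set T then 5 else 0)" (is "card ?B \<le> ?c")
proof -
  have good: "good_row (x, d, e, T)"
    using R r by (simp add: good_rows_def list_all_iff del: good_row.simps)
  have d: "d \<in> set residue_vecs" "dot d x = 0" "5 dvd dot d e"
    using good by simp_all
  have sep: "\<forall>l\<in>set residue_vecs. 5 dvd dot l x \<longrightarrow> 5 dvd dot l e \<longrightarrow> l = d"
    using good unfolding good_row.simps list_all_iff by blast
  have "distinct T" "\<forall>j\<in>set T. 0 \<le> j \<and> j \<le> 4"
    using good unfolding good_row.simps list_all_iff by blast+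
  then have T: "distinct T" "set T \<subseteq> {0..4}" by auto
  have inc: "dot (lift l m) (row_point (r, i, j)) = 0 \<longleftrightarrow>
      of_int (dot l x) + \<pi> * of_int (i * dot l e + j * dot l (pivot d) + dot m x) = 0" for i j
    unfolding r by (simp only: dot_row_point)
  have on: "5 dvd dot l x" if "(i, j) \<in> ?B" for i j
  proof -
    have "of_int (dot l x) + \<pi> * of_int (i * dot l e + j * dot l (pivot d) + dot m x) = 0"
      using that by (simp only: inc mem_Collect_eq prod.case)
    then have "of_int (dot l x) = \<pi> * - of_int (i * dot l e + j * dot l (pivot d) + dot m x)"
      by (simp only: mult_minus_right eq_neg_iff_add_eq_0)
    then have "\<pi> dvd of_int (dot l x)" by (rule dvdI)
    then show ?thesis by (simp only: pi_dvd_of_int_iff)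
  qed
  show ?thesis
  proof (cases "d = l")
    case True
    have "?B \<subseteq> {0..4} \<times> ({(- dot m x) mod 5} \<inter> set T)"
    proof
      fix t assume "t \<in> ?B"
      then obtain i j where t: "t = (i, j)" "i \<in> {0..4}" "j \<in> set T"
        "dot (lift l m) (row_point (r, i, j)) = 0" by auto
      have "5 dvd i * dot l e + j + dot m x"
        using t(4) d unfolding inc True
        by (simp add: dot_pivot pi_of_int_eq_0_iff del: of_int_add of_int_mult)
      moreover have "5 dvd i * dot l e" using d(3) unfolding True by (rule dvd_mult)
      ultimately have "5 dvd j + dot m x" by (simp add: add.assoc dvd_add_right_iff)
      then have "j mod 5 = (- dot m x) mod 5"
        using mod_eq_dvd_iff [of j 5 "- dot m x"] by simp
      moreover have "j mod 5 = j" using T t(3) by auto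
      ultimately show "t \<in> {0..4} \<times> ({(- dot m x) mod 5} \<inter> set T)" using t by simp
    qed
    then have "card ?B \<le> card ({0..4::int} \<times> ({(- dot m x) mod 5} \<inter> set T))"
      by (rule card_mono [rotated]) simp
    then show ?thesis
      using True by (cases "(- dot m x) mod 5 \<in> set T") (simp_all add: card_cartesian_product)
  next
    case False
    show ?thesis
    proof (cases "5 dvd dot l x")
      case True
      then have e: "\<not> 5 dvd dot l e" using sep l False by blast
      have "inj_on snd ?B"
      proof (rule inj_onI, clarsimp)
        fix i i' j
        assume i: "0 \<le> i" "i \<le> 4" "0 \<le> i'" "i' \<le> 4"
          and z: "dot (lift l m) (row_point (r, i, j)) = 0" "dot (lift l m) (row_point (r, i', j)) = 0"
        have "\<pi> * of_int (i * dot l e + j * dot l (pivot d) + dot m x) =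
            \<pi> * of_int (i' * dot l e + j * dot l (pivot d) + dot m x)"
          by (rule add_left_imp_eq [of "of_int (dot l x)"]) (simp only: z [unfolded inc])
        moreover have "\<pi> * of_int ((i - i') * dot l e) =
            \<pi> * of_int (i * dot l e + j * dot l (pivot d) + dot m x) -
            \<pi> * of_int (i' * dot l e + j * dot l (pivot d) + dot m x)"
          by (simp add: algebra_simps)
        ultimately have "\<pi> * of_int ((i - i') * dot l e) = 0" by (simp only: diff_self)
        then have "5 dvd (i - i') * dot l e" by (simp only: pi_of_int_eq_0_iff)
        moreover have "prime (5 :: int)" by simp
        ultimately have "5 dvd i - i'" using e prime_dvd_mult_iff by blast
        then show "i = i'" using i by (intro eq_if_5_dvd_diff) auto
      qed
      then have "card ?B \<le> card (set T)"
        by (rule card_inj_on_le) auto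
      then show ?thesis using T False True by (simp add: distinct_card)
    next
      case f: False
      then have "?B = {}" using on by auto
      then show ?thesis by (simp only: card.empty)
    qed
  qed
qed

text \<open>Chosen points on a line come from indices at which its normalised covector vanishes;
  summing the bounds for the single rows gives the quantity tested by
  \<open>load_bound\<close>.\<close>

theorem proj_arc_row_arc:
  assumes R: "good_rows R" and n: "load_bound n R"
  shows "proj_arc (row_arc R) (\<Sum>(x, d, e, T) \<leftarrow> R. 5 * length T) n"
  unfolding proj_arc_def
proof (intro conjI ballI)
  show "row_arc R \<subseteq> hpoints" by (rule row_arc_subset_hpoints [OF R])
  show "card (row_arc R) = (\<Sum>(x, d, e, T) \<leftarrow> R. 5 * length T)" by (rule card_row_arc [OF R])
  fix L :: "'a vec3 set" assume "L \<in> hlines"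
  then obtain l0 where l0: "unimodular l0" "\<And>p. p \<in> L \<Longrightarrow> dot l0 p = 0"
    using hline_annihilator by blast
  obtain l m k where l: "l \<in> set residue_vecs" and m: "m \<in> set small_vecs"
    and k: "vsmul l0 k = lift l m"
    using normalise_covector [OF l0(1)] by blast
  have zero: "dot (lift l m) p = 0" if "p \<in> L" for p
    using l0(2) [OF that] by (simp add: k [symmetric] dot_simps)
  define B where "B = (\<lambda>r :: row. {(i, j) \<in> {0..4} \<times> set (snd (snd (snd r))). dot (lift l m) (row_point (r, i, j)) = 0})"
  define c where "c = (\<lambda>(x, d, e :: int vec3, T).
    (if d \<noteq> l \<and> 5 dvd dot l x then length T else 0) +
    (if d = l \<and> (- dot m x) mod 5 \<in> set T then 5 else 0))"
  have fin: "finite (B r)" for r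
    unfolding B_def by (rule finite_subset [of _ "{0..4} \<times> set (snd (snd (snd r)))"]) auto
  have "{P \<in> row_arc R. P \<subseteq> L} \<subseteq> (\<lambda>t. range (vsmul (row_point t))) ` (SIGMA r : set R. B r)"
  proof
    fix P assume "P \<in> {P \<in> row_arc R. P \<subseteq> L}"
    then obtain t where t: "t \<in> row_indices R" "P = range (vsmul (row_point t))" "P \<subseteq> L"
      by (auto simp: row_arc_def)
    have "vsmul (row_point t) 1 \<in> P" unfolding t(2) by (rule rangeI)
    then have "dot (lift l m) (row_point t) = 0" using t(3) zero by (metis subsetD vsmul_1)
    then have "t \<in> (SIGMA r : set R. B r)"
      using t(1) by (auto simp: row_indices_def B_def)
    then show "P \<in> (\<lambda>t. range (vsmul (row_point t))) ` (SIGMA r : set R. B r)"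
      using t(2) by blast
  qed
  then have "card {P \<in> row_arc R. P \<subseteq> L} \<le> card (SIGMA r : set R. B r)"
    using fin by (intro surj_card_le) auto
  also have "\<dots> = (\<Sum>r\<in>set R. card (B r))" using fin by (simp add: card_SigmaI)
  also have "\<dots> \<le> (\<Sum>r\<in>set R. c r)"
  proof (rule sum_mono)
    fix r assume r: "r \<in> set R"
    obtain x d e T where r_eq: "r = (x, d, e, T)" by (metis prod_cases4)
    show "card (B r) \<le> c r"
      using card_incident_row_points [OF R l r_eq r, of m] by (simp only: B_def c_def r_eq prod.case snd_conv)
  qed
  also have "\<dots> = sum_list (map c R)"
    using R by (simp add: good_rows_def sum_list_distinct_conv_sum_set)
  also have "\<dots> = (\<Sum>(x, d, e, T) \<leftarrow> R. if d \<noteq> l \<and> 5 dvd dot l x then length T else 0) +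
      (\<Sum>(x, d, e, T) \<leftarrow> filter (\<lambda>(x, d, e, T). d = l) R. if (- dot m x) mod 5 \<in> set T then 5 else 0)"
    by (induction R) (auto simp: c_def)
  also have "\<dots> \<le> n"
    using n l m by (simp add: load_bound_def list_all_iff Let_def)
  finally show "card {P \<in> row_arc R. P \<subseteq> L} \<le> n" .
qed

end

section \<open>The two rings\<close>

lemma chain_ring5_Z25: "chain_ring5 (5 :: 25)"
proof
  have of_int_0: "(of_int k :: 25) = 0 \<longleftrightarrow> 25 dvd k" for k
    by (simp add: of_int_eq_0_iff_char_dvd)
  show "(5 :: 25) * 5 = 0" by simp
  show "(5 :: 25) * of_int k = 0 \<longleftrightarrow> 5 dvd k" for k
  proof -
    have "(5 :: 25) * of_int k = 0 \<longleftrightarrow> 25 dvd 5 * k"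
      using of_int_0 [of "5 * k"] by simp
    then show ?thesis by presburger
  qed
  show "\<exists>a b. r = of_int a + 5 * of_int b" for r :: 25
  proof -
    obtain z where "r = of_int z" by (cases r)
    then have "r = of_int z + 5 * of_int 0" by simp
    then show ?thesis by blast
  qed
qed simp

lemma of_int_dual: "of_int k = Dual (of_int k) 0"
proof (induction k rule: int_induct [where k = 0])
qed (simp_all add: zero_dual_def one_dual_def plus_dual_def minus_dual_def)

lemma chain_ring5_S5: "chain_ring5 (Dual 0 1 :: S5)"
proof
  have of_int_0: "(of_int k :: 5) = 0 \<longleftrightarrow> 5 dvd k" for k
    by (simp add: of_int_eq_0_iff_char_dvd)
  show "(Dual 0 1 :: S5) * Dual 0 1 = 0" by (simp add: times_dual_def zero_dual_def)
  show "(Dual 0 1 :: S5) * of_int k = 0 \<longleftrightarrow> 5 dvd k" for k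
    by (simp add: times_dual_def zero_dual_def of_int_dual of_int_0)
  show "\<exists>a b. r = of_int a + Dual 0 1 * of_int b" for r :: S5
  proof (cases r)
    case (Dual p q)
    \<comment> \<open>The type \<open>5\<close> is a \<open>bit1\<close> type, so its elements are
      images of integers.\<close>
    obtain a b where "p = of_int a" "q = of_int b" by (metis bit1_cases)
    then show ?thesis
      by (intro exI [of _ a] exI [of _ b]) (simp add: Dual of_int_dual times_dual_def plus_dual_def)
  qed
  have "(of_int 5 :: S5) = 0" by (simp only: of_int_dual zero_dual_def) simp
  then show "(Dual 0 1 :: S5) dvd 5" by simp
qed

section \<open>The three selections of segments\<close>

text \<open>The fibre over (1, 3, 1) stays empty. In all three tables, negative coordinates arise by
  subtracting a multiple of 5 from the normalised \<open>x\<close> at the leading coordinate of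
  \<open>d\<close>, which makes \<open>dot d x\<close> vanish over the integers.\<close>

definition rows15 :: "row list" where
  "rows15 = [
    ((0, 0, 1), (1, 3, 0), (1, 3, 0), [0, 4]), ((0, 1, 0), (1, 0, 4), (1, 0, 1), [0, 4]),
    ((-5, 1, 1), (1, 1, 4), (1, 0, 1), [0, 3, 4]), ((0, -4, 2), (0, 1, 2), (1, 0, 0), [0, 4]),
    ((-10, 1, 3), (1, 4, 2), (1, 0, 2), [0, 3, 4]), ((-15, 1, 4), (1, 3, 3), (1, 0, 3), [0, 3, 4]),
    ((1, 0, 0), (0, 1, 2), (0, 1, 2), [2, 4]), ((-4, 0, 1), (1, 0, 4), (0, 1, 0), [2, 4]),
    ((-4, 0, 2), (1, 4, 2), (0, 1, 3), [1, 2, 3]), ((-9, 0, 3), (1, 0, 3), (0, 1, 0), [0, 3, 4]),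
    ((-4, 0, 4), (1, 0, 1), (0, 1, 0), [0, 3, 4]), ((-4, 1, 0), (1, 4, 2), (0, 1, 3), [0, 3, 4]),
    ((-4, 1, 1), (1, 0, 4), (0, 1, 0), [0, 4]), ((1, -4, 2), (0, 1, 2), (0, 1, 2), [0, 4]),
    ((-14, 1, 3), (1, 2, 4), (0, 1, 2), [0, 3, 4]), ((1, -4, 4), (0, 1, 1), (0, 1, 4), [0, 3, 4]),
    ((-4, 2, 0), (1, 2, 0), (0, 0, 1), [0, 3, 4]), ((-4, 2, 1), (1, 0, 4), (0, 1, 0), [0, 1]),
    ((1, -8, 2), (0, 1, 4), (0, 1, 1), [0, 1, 3]), ((-14, 2, 3), (1, 4, 2), (0, 1, 3), [0]),
    ((1, -8, 4), (0, 1, 2), (0, 1, 2), [0, 1]), ((-9, 3, 0), (1, 3, 0), (0, 0, 1), [3, 4]),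
    ((-9, 3, 2), (1, 3, 0), (0, 0, 1), [0, 4]), ((-9, 3, 3), (1, 3, 0), (0, 0, 1), [0, 2]),
    ((-9, 3, 4), (1, 3, 0), (0, 0, 1), [1, 2]), ((-4, 4, 0), (1, 1, 0), (0, 0, 1), [0, 3, 4]),
    ((-4, 4, 1), (1, 0, 4), (0, 1, 0), [1, 2]), ((-14, 4, 2), (1, 3, 1), (0, 1, 2), [0, 1, 2]),
    ((1, -6, 3), (0, 1, 2), (0, 1, 2), [1, 2]), ((-24, 4, 4), (1, 4, 2), (0, 1, 3), [1])]"

definition rows16 :: "row list" where
  "rows16 = [
    ((0, 0, 1), (1, 1, 0), (1, 4, 0), [0, 4]), ((0, 1, 0), (1, 0, 1), (1, 0, 4), [0, 3, 4]),
    ((-5, 1, 1), (1, 2, 3), (1, 0, 3), [0, 2, 3, 4]), ((-5, 1, 2), (1, 1, 2), (1, 0, 2), [0, 3, 4]),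
    ((-10, 1, 3), (1, 4, 2), (1, 0, 2), [0]), ((-15, 1, 4), (1, 3, 3), (1, 0, 3), [0, 3, 4]),
    ((1, 0, 0), (0, 1, 0), (0, 0, 1), [2, 3]), ((1, 0, 1), (0, 1, 0), (0, 0, 1), [0, 4]),
    ((-4, 0, 2), (1, 4, 2), (0, 1, 3), [3]), ((1, 0, 3), (0, 1, 0), (0, 0, 1), [0, 2]),
    ((-4, 0, 4), (1, 0, 1), (0, 1, 0), [4]), ((-4, 1, 0), (1, 4, 2), (0, 1, 3), [0, 3, 4]),
    ((-4, 1, 1), (1, 2, 2), (0, 1, 4), [0, 2, 3, 4]), ((-4, 1, 2), (1, 2, 1), (0, 1, 3), [0, 4]),
    ((1, -9, 3), (0, 1, 3), (0, 1, 3), [0, 2, 3, 4]), ((-19, 1, 4), (1, 3, 4), (0, 1, 3), [0]),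
    ((-4, 2, 0), (1, 2, 1), (0, 1, 3), [1, 3]), ((-4, 2, 1), (1, 1, 2), (0, 1, 2), [0, 3]),
    ((-14, 2, 2), (1, 3, 4), (0, 1, 3), [2, 3, 4]), ((-14, 2, 3), (1, 4, 2), (0, 1, 3), [1, 2, 4]),
    ((-4, 2, 4), (1, 0, 1), (0, 1, 0), [0, 3, 4]), ((-9, 3, 0), (1, 3, 4), (0, 1, 3), [0, 2]),
    ((-14, 3, 1), (1, 4, 2), (0, 1, 3), [0, 1, 2]), ((1, -2, 2), (0, 1, 1), (0, 1, 4), [0, 1, 2, 4]),
    ((-9, 3, 3), (1, 2, 1), (0, 1, 3), [0, 4]), ((-4, 3, 4), (1, 0, 1), (0, 1, 0), [0, 1, 2]),
    ((-4, 4, 0), (1, 1, 0), (0, 0, 1), [1, 2]), ((-4, 4, 1), (1, 1, 0), (0, 0, 1), [0, 3]),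
    ((-4, 4, 2), (1, 1, 0), (0, 0, 1), [1, 2, 3]), ((-4, 4, 3), (1, 1, 0), (0, 0, 1), [0, 4]),
    ((-4, 4, 4), (1, 0, 1), (0, 1, 0), [3])]"

definition rows17 :: "row list" where
  "rows17 = [
    ((0, 0, 1), (1, 0, 0), (0, 1, 0), [0, 3, 4]), ((0, 1, 0), (1, 0, 0), (0, 0, 1), [3, 4]),
    ((0, 1, 1), (1, 0, 0), (0, 0, 1), [0, 4]), ((0, 1, 2), (1, 0, 0), (0, 0, 1), [1, 3]),
    ((-5, 1, 3), (1, 2, 1), (1, 0, 4), [0]), ((0, 1, 4), (1, 0, 0), (0, 0, 1), [0, 2]),
    ((1, 0, 0), (0, 1, 3), (0, 1, 3), [1, 2]), ((-4, 0, 1), (1, 1, 4), (0, 1, 1), [0, 4]),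
    ((1, 0, 2), (0, 1, 0), (0, 0, 1), [0, 1, 3, 4]), ((-9, 0, 3), (1, 0, 3), (0, 1, 0), [2]),
    ((-4, 0, 4), (1, 2, 1), (0, 1, 3), [1, 3, 4]), ((-4, 1, 0), (1, 4, 3), (0, 1, 2), [0, 3, 4]),
    ((1, -4, 1), (0, 1, 4), (0, 1, 1), [0, 2, 3, 4]), ((-4, 1, 2), (1, 2, 1), (0, 1, 3), [0, 4]),
    ((-9, 1, 3), (1, 0, 3), (0, 1, 0), [0, 4]), ((1, -4, 4), (0, 1, 1), (0, 1, 4), [0, 3, 4]),
    ((-4, 2, 0), (1, 2, 1), (0, 1, 3), [1, 2, 3]), ((1, -3, 1), (0, 1, 3), (0, 1, 3), [0, 1, 3]),
    ((-14, 2, 2), (1, 4, 3), (0, 1, 2), [0, 1, 3]), ((-9, 2, 3), (1, 0, 3), (0, 1, 0), [0]),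
    ((-4, 2, 4), (1, 0, 1), (0, 1, 0), [0, 1, 3]), ((-9, 3, 0), (1, 3, 4), (0, 1, 3), [0, 1, 2, 4]),
    ((1, -2, 1), (0, 1, 2), (0, 1, 2), [0, 1, 2, 4]), ((-14, 3, 2), (1, 2, 4), (0, 1, 2), [0, 2, 4]),
    ((-9, 3, 3), (1, 0, 3), (0, 1, 0), [0, 2]), ((1, -12, 4), (0, 1, 3), (0, 1, 3), [0]),
    ((-4, 4, 0), (1, 1, 4), (0, 1, 1), [0, 1, 2]), ((-9, 4, 1), (1, 2, 1), (0, 1, 3), [0, 2]),
    ((-24, 4, 2), (1, 4, 4), (0, 1, 4), [0, 1, 2]), ((-9, 4, 3), (1, 0, 3), (0, 1, 0), [1, 2, 3]),
    ((-24, 4, 4), (1, 3, 3), (0, 1, 4), [0, 1, 2])]"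

section \<open>Evaluation of the tables and conclusion\<close>

lemma good_rows15: "good_rows rows15"
  by code_simp

lemma load_bound15: "load_bound 15 rows15"
  by code_simp

lemma size_rows15: "(\<Sum>(x, d, e, T) \<leftarrow> rows15. 5 * length T) = 355"
  by code_simp

lemma good_rows16: "good_rows rows16"
  by code_simp

lemma load_bound16: "load_bound 16 rows16"
  by code_simp

lemma size_rows16: "(\<Sum>(x, d, e, T) \<leftarrow> rows16. 5 * length T) = 375"
  by code_simp

lemma good_rows17: "good_rows rows17"
  by code_simp

lemma load_bound17: "load_bound 17 rows17"
  by code_simp

lemma size_rows17: "(\<Sum>(x, d, e, T) \<leftarrow> rows17. 5 * length T) = 395"
  by code_simp

lemma chain_ring5_arcs:
  fixes \<pi> :: "'a::comm_ring_1"
  assumes "chain_ring5 \<pi>"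
  shows "\<exists>K :: 'a vec3 set set. proj_arc K 355 15"
    and "\<exists>K :: 'a vec3 set set. proj_arc K 375 16"
    and "\<exists>K :: 'a vec3 set set. proj_arc K 395 17"
  using chain_ring5.proj_arc_row_arc [OF assms good_rows15 load_bound15]
    chain_ring5.proj_arc_row_arc [OF assms good_rows16 load_bound16]
    chain_ring5.proj_arc_row_arc [OF assms good_rows17 load_bound17]
  unfolding size_rows15 size_rows16 size_rows17 by blast+

theorem theorem3p9:
  shows "(\<exists>K :: (25 vec3) set set. proj_arc K 355 15) \<and>
         (\<exists>K :: (25 vec3) set set. proj_arc K 375 16) \<and>
         (\<exists>K :: (25 vec3) set set. proj_arc K 395 17) \<and>
         (\<exists>K :: (S5 vec3) set set. proj_arc K 355 15) \<and>
         (\<exists>K :: (S5 vec3) set set. proj_arc K 375 16) \<and>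
         (\<exists>K :: (S5 vec3) set set. proj_arc K 395 17)"
  using chain_ring5_arcs [OF chain_ring5_Z25] chain_ring5_arcs [OF chain_ring5_S5] by blast

end
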